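(* Let $\mathcal{H}$ be a separable Hilbert space, $\mathbb{I}$ a finite or countably infinite index set, $m\in\mathbb{N}$, let $\{f_{ij}\}_{i\in\mathbb{I},j\in[m]}$ be a woven frame for $\mathcal{H}$ with universal bounds $C$ and $D$, and let $P$ denote the orthogonal projection of $\mathcal{H}$ onto a closed subspace $W$ of $\mathcal{H}$. Then $\{Pf_{ij}\}_{i\in\mathbb{I},j\in[m]}$ is a woven frame for $W$ with the same universal bounds $C$ and $D$.
   Context: $[m]=\{1,\dots,m\}$. A partition $\{\sigma_j\}_{j\in[m]}$ of $\mathbb{I}$ consists of pairwise disjoint, possibly empty subsets of $\mathbb{I}$ with union $\mathbb{I}$. A sequence $\{f_i\}$ in a Hilbert space $\mathcal{K}$ is a frame for $\mathcal{K}$ with bounds $0<A,B<\infty$ if $A\|f\|^2\le\sum_i|\langle f,f_i\rangle|^2\le B\|f\|^2$ for all $f\in\mathcal{K}$. A family $\{f_{ij}\}_{i\in\mathbb{I},j\in[m]}$ is a woven frame for $\mathcal{K}$ with universal bounds $C,D>0$ if each $\{f_{ij}\}_{i\in\mathbb{I}}$ ($j\in[m]$) is a frame for $\mathcal{K}$ and for every partition $\{\sigma_j\}_{j\in[m]}$ of $\mathbb{I}$ the family $\{f_{ij}\}_{i\in\sigma_j,j\in[m]}$ is a frame for $\mathcal{K}$ with bounds $C,D$. *)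

theory Defs
  imports "HOL-Analysis.Analysis"
begin

text \<open>The scalars of a Hilbert space are the reals or the complex numbers. The class below
  has both as instances, so that the two cases are treated uniformly; up to isomorphism it has
  no others, since the reals and the complex numbers are the only real normed fields.\<close>

class conj_normed_field = real_normed_field +
  fixes conjugate :: "'a \<Rightarrow> 'a"
  assumes conjugate_add: "conjugate (x + y) = conjugate x + conjugate y"
    and conjugate_mult: "conjugate (x * y) = conjugate x * conjugate y"
    and conjugate_conjugate: "conjugate (conjugate x) = x"
    and conjugate_scaleR: "conjugate (r *\<^sub>R x) = r *\<^sub>R conjugate x"
    and mult_conjugate: "x * conjugate x = (norm x)\<^sup>2 *\<^sub>R 1"

instantiation real :: conj_normed_field
begin
definition conjugate_real :: "real \<Rightarrow> real" where "conjugate_real x = x"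
instance by standard (simp_all add: conjugate_real_def power2_eq_square)
end

instantiation complex :: conj_normed_field
begin
definition conjugate_complex :: "complex \<Rightarrow> complex" where "conjugate_complex = cnj"
instance
  by standard (simp_all add: conjugate_complex_def scaleR_conv_of_real complex_norm_square del: of_real_power)
end

text \<open>Completeness comes from the sort \<open>banach\<close>. The inner product is linear in its first
  argument.\<close>

locale hilbert_space = vector_space scale
  for scale :: "'k::conj_normed_field \<Rightarrow> 'h::banach \<Rightarrow> 'h" +
  fixes ip :: "'h \<Rightarrow> 'h \<Rightarrow> 'k"
  assumes scale_of_real: "scale (of_real r) x = r *\<^sub>R x"
    and ip_add_left: "ip (x + y) z = ip x z + ip y z"
    and ip_scale_left: "ip (scale c x) y = c * ip x y"
    and ip_commute: "ip x y = conjugate (ip y x)"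
    and ip_self: "ip x x = of_real ((norm x)\<^sup>2)"

lemma hilbert_space_real:
  "hilbert_space (scaleR :: real \<Rightarrow> 'a \<Rightarrow> 'a::{real_inner, banach}) inner"
  by unfold_locales
    (simp_all add: algebra_simps conjugate_real_def power2_norm_eq_inner inner_commute)

lemma hilbert_space_complex: "hilbert_space (*) (\<lambda>x y :: complex. x * cnj y)"
  by unfold_locales
    (simp_all add: algebra_simps conjugate_complex_def scaleR_conv_of_real complex_norm_square
      del: of_real_power)

definition orthogonal_projection ::
    "('h \<Rightarrow> 'h \<Rightarrow> 'k::zero) \<Rightarrow> 'h::minus set \<Rightarrow> 'h \<Rightarrow> 'h" where
  "orthogonal_projection ip W x = (THE p. p \<in> W \<and> (\<forall>w\<in>W. ip (x - p) w = 0))"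

text \<open>\<open>K\<close> is meant to be a closed subspace of the ambient Hilbert space, regarded as a Hilbert
  space with the restricted inner product. Summability is demanded explicitly because
  \<open>infsum\<close> is \<open>0\<close> for a divergent sum.\<close>

definition frame_with_bounds ::
    "('h::real_normed_vector \<Rightarrow> 'h \<Rightarrow> 'k::real_normed_vector) \<Rightarrow> 'h set \<Rightarrow> 'i set \<Rightarrow>
      ('i \<Rightarrow> 'h) \<Rightarrow> real \<Rightarrow> real \<Rightarrow> bool" where
  "frame_with_bounds ip K I g A B \<longleftrightarrow>
     0 < A \<and> 0 < B \<and> g ` I \<subseteq> K \<and>
     (\<forall>f\<in>K. (\<lambda>i. (norm (ip f (g i)))\<^sup>2) summable_on I \<and>
        A * (norm f)\<^sup>2 \<le> (\<Sum>\<^sub>\<infinity>i\<in>I. (norm (ip f (g i)))\<^sup>2) \<and>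
        (\<Sum>\<^sub>\<infinity>i\<in>I. (norm (ip f (g i)))\<^sup>2) \<le> B * (norm f)\<^sup>2)"

definition frame ::
    "('h::real_normed_vector \<Rightarrow> 'h \<Rightarrow> 'k::real_normed_vector) \<Rightarrow> 'h set \<Rightarrow> 'i set \<Rightarrow> ('i \<Rightarrow> 'h) \<Rightarrow> bool" where
  "frame ip K I g \<longleftrightarrow> (\<exists>A B. frame_with_bounds ip K I g A B)"

definition indexed_partition :: "'i set \<Rightarrow> nat \<Rightarrow> (nat \<Rightarrow> 'i set) \<Rightarrow> bool" where
  "indexed_partition I m \<sigma> \<longleftrightarrow>
     disjoint_family_on \<sigma> {1..m} \<and> (\<Union>j\<in>{1..m}. \<sigma> j) = I"

definition woven_frame ::
    "('h::real_normed_vector \<Rightarrow> 'h \<Rightarrow> 'k::real_normed_vector) \<Rightarrow> 'h set \<Rightarrow> 'i set \<Rightarrow> nat \<Rightarrow>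
      ('i \<Rightarrow> nat \<Rightarrow> 'h) \<Rightarrow> real \<Rightarrow> real \<Rightarrow> bool" where
  "woven_frame ip K I m f C D \<longleftrightarrow>
     0 < C \<and> 0 < D \<and>
     (\<forall>j\<in>{1..m}. frame ip K I (\<lambda>i. f i j)) \<and>
     (\<forall>\<sigma>. indexed_partition I m \<sigma> \<longrightarrow>
        frame_with_bounds ip K (SIGMA j:{1..m}. \<sigma> j) (\<lambda>(j, i). f i j) C D)"

end

theory Submission
  imports Defs
begin

text \<open>The orthogonal projection \<open>P\<close> is self-adjoint and fixes \<open>W\<close>, so \<open>\<langle>w, P x\<rangle> = \<langle>w, x\<rangle>\<close> for
  \<open>w \<in> W\<close>. Hence for vectors of \<open>W\<close> the frame sums of the projected family are literally those of
  the original family. As the projection is given by a definite description, this needs the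
  projection theorem: a sequence in \<open>W\<close> minimising the distance to \<open>x\<close> is Cauchy by the
  parallelogram law, and its limit is the foot of the perpendicular.\<close>

lemma conjugate_0 [simp]: "conjugate (0 :: 'a::conj_normed_field) = 0"
  using conjugate_add[of "0::'a" 0] by simp

context hilbert_space
begin

lemma ip_diff_left: "ip (x - y) z = ip x z - ip y z"
  using ip_add_left[of "x - y" y z] by simp

lemma ip_add_right: "ip x (y + z) = ip x y + ip x z"
  by (metis ip_commute ip_add_left conjugate_add)

lemma ip_diff_right: "ip x (y - z) = ip x y - ip x z"
  using ip_add_right[of x "y - z" z] by simp

lemma ip_eq_0_commute: "ip x y = 0 \<longleftrightarrow> ip y x = 0"
  by (metis ip_commute conjugate_0)

lemma parallelogram_law:
  fixes x y :: 'h
  shows "(norm (x + y))\<^sup>2 + (norm (x - y))\<^sup>2 = 2 * (norm x)\<^sup>2 + 2 * (norm y)\<^sup>2"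
proof -
  have "ip (x + y) (x + y) + ip (x - y) (x - y) = 2 * ip x x + 2 * ip y y"
    by (simp add: ip_add_left ip_diff_left ip_add_right ip_diff_right)
  \<comment> \<open>The expansion lives in the scalar field \<open>'k\<close>; injectivity of
    \<open>of_real\<close> brings it back to the reals.\<close>
  then have "(of_real ((norm (x + y))\<^sup>2 + (norm (x - y))\<^sup>2) :: 'k)
      = of_real (2 * (norm x)\<^sup>2 + 2 * (norm y)\<^sup>2)"
    by (simp add: ip_self)
  then show ?thesis
    by (simp only: of_real_eq_iff)
qed

lemma pythagoras:
  assumes "ip x y = 0"
  shows "(norm (x + y))\<^sup>2 = (norm x)\<^sup>2 + (norm y)\<^sup>2"
proof -
  have "ip (x + y) (x + y) = ip x x + ip y y"
    using assms ip_eq_0_commute[of x y] by (simp add: ip_add_left ip_add_right)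
  then have "(of_real ((norm (x + y))\<^sup>2) :: 'k) = of_real ((norm x)\<^sup>2 + (norm y)\<^sup>2)"
    by (simp add: ip_self)
  then show ?thesis
    by (simp only: of_real_eq_iff)
qed

text \<open>Here \<open>subspace\<close> refers to \<open>scale\<close>. Midpoints need real
  multiples, which are multiples by the scalars \<open>of_real r\<close>.\<close>

lemma subspace_scaleR: "subspace W \<Longrightarrow> x \<in> W \<Longrightarrow> r *\<^sub>R x \<in> W"
  by (metis scale_of_real subspace_scale)

text \<open>The midpoint of \<open>u\<close> and \<open>v\<close> lies in \<open>W\<close>, so its
  distance from \<open>x\<close> is at least \<open>d = infdist x W\<close>. The parallelogram law
  for \<open>x - u\<close> and \<open>x - v\<close> then bounds the left side by 4 (d^2 + e) - 4
  d^2.\<close>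

lemma norm_diff_le_of_near_minimisers:
  assumes W: "subspace W" "u \<in> W" "v \<in> W"
    and "(norm (x - u))\<^sup>2 \<le> (infdist x W)\<^sup>2 + e" "(norm (x - v))\<^sup>2 \<le> (infdist x W)\<^sup>2 + e"
  shows "(norm (u - v))\<^sup>2 \<le> 4 * e"
proof -
  have "(1/2) *\<^sub>R (u + v) \<in> W"
    using W by (intro subspace_scaleR subspace_add)
  then have "infdist x W \<le> norm (x - (1/2) *\<^sub>R (u + v))"
    by (metis infdist_le dist_norm)
  then have "(infdist x W)\<^sup>2 \<le> (norm (x - (1/2) *\<^sub>R (u + v)))\<^sup>2"
    by (simp add: infdist_nonneg power_mono)
  moreover have "(x - u) + (x - v) = 2 *\<^sub>R (x - (1/2) *\<^sub>R (u + v))"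
    by (simp add: algebra_simps flip: scaleR_2)
  then have "(norm ((x - u) + (x - v)))\<^sup>2 = 4 * (norm (x - (1/2) *\<^sub>R (u + v)))\<^sup>2"
    by (simp add: power_mult_distrib)
  moreover have "norm ((x - u) - (x - v)) = norm (u - v)"
    by (simp add: norm_minus_commute)
  ultimately show ?thesis
    using parallelogram_law[of "x - u" "x - v"] assms(4,5) by simp
qed

lemma nearest_point_exists:
  assumes W: "subspace W" "closed W"
  obtains p where "p \<in> W" "norm (x - p) = infdist x W"
proof -
  let ?d = "infdist x W"
  \<comment> \<open>\<open>infdist\<close> is the infimum of the distances only for nonempty
    \<open>W\<close>; for the empty set it defaults to 0.\<close>
  have ne: "W \<noteq> {}"
    using subspace_0[OF W(1)] by blast
  have "\<exists>w\<in>W. (norm (x - w))\<^sup>2 \<le> ?d\<^sup>2 + inverse (real (Suc n))" for n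
  proof -
    \<comment> \<open>The slack is added to the squared distance, the form the parallelogram
      estimate takes.\<close>
    have "?d < sqrt (?d\<^sup>2 + inverse (real (Suc n)))"
      by (rule real_less_rsqrt) simp
    then obtain w where w: "w \<in> W" "dist x w < sqrt (?d\<^sup>2 + inverse (real (Suc n)))"
      using ne infdist_notempty[of W x] cInf_lessD[of "dist x ` W"] by auto
    then have "(norm (x - w))\<^sup>2 \<le> (sqrt (?d\<^sup>2 + inverse (real (Suc n))))\<^sup>2"
      by (intro power_mono) (auto simp: dist_norm)
    then show ?thesis
      using w(1) by (intro bexI[of _ w]) auto
  qed
  then obtain w where wW: "\<And>n. w n \<in> W"
    and w: "\<And>n. (norm (x - w n))\<^sup>2 \<le> ?d\<^sup>2 + inverse (real (Suc n))"
    by metis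
  have "Cauchy w"
  proof (rule metric_CauchyI)
    fix e :: real
    assume "0 < e"
    \<comment> \<open>The quarter cancels the factor 4 in
      \<open>norm_diff_le_of_near_minimisers\<close>.\<close>
    then obtain N where N: "inverse (real (Suc N)) < e\<^sup>2 / 4"
      using reals_Archimedean[of "e\<^sup>2 / 4"] by auto
    have near: "(norm (x - w n))\<^sup>2 \<le> ?d\<^sup>2 + inverse (real (Suc N))" if "N \<le> n" for n
    proof -
      have "inverse (real (Suc n)) \<le> inverse (real (Suc N))"
        using that by (intro le_imp_inverse_le) auto
      then show ?thesis
        using w[of n] by linarith
    qed
    have "dist (w a) (w b) < e" if "N \<le> a" "N \<le> b" for a b
    proof -
      have "(norm (w a - w b))\<^sup>2 < e\<^sup>2"
        using norm_diff_le_of_near_minimisers[OF W(1) wW wW near[OF that(1)] near[OF that(2)]] N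
        by linarith
      then show ?thesis
        using \<open>0 < e\<close> by (simp add: dist_norm power_less_imp_less_base)
    qed
    then show "\<exists>N. \<forall>a\<ge>N. \<forall>b\<ge>N. dist (w a) (w b) < e"
      by blast
  qed
  then obtain p where p: "w \<longlonglongrightarrow> p"
    using Cauchy_convergent convergent_def by blast
  have "p \<in> W"
    using W(2) wW p closed_sequentially by blast
  moreover have "(norm (x - p))\<^sup>2 \<le> ?d\<^sup>2 + 0"
  proof (rule LIMSEQ_le)
    show "(\<lambda>n. (norm (x - w n))\<^sup>2) \<longlonglongrightarrow> (norm (x - p))\<^sup>2"
      by (intro tendsto_intros p)
    show "(\<lambda>n. ?d\<^sup>2 + inverse (real (Suc n))) \<longlonglongrightarrow> ?d\<^sup>2 + 0"
      by (intro tendsto_intros LIMSEQ_inverse_real_of_nat)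
  qed (use w in blast)
  then have "norm (x - p) \<le> ?d"
    using infdist_nonneg power2_le_imp_le by fastforce
  then have "norm (x - p) = ?d"
    using infdist_le[OF \<open>p \<in> W\<close>, of x] by (simp add: dist_norm)
  ultimately show thesis
    using that by blast
qed

text \<open>Moving \<open>p\<close> by the component \<open>scale c w\<close> of
  \<open>x - p\<close> along \<open>w\<close> stays in \<open>W\<close> and, by Pythagoras, lowers
  the squared distance by that component's squared norm. Minimality forces the component to
  vanish.\<close>

lemma nearest_point_orthogonal:
  assumes W: "subspace W" and "p \<in> W" "norm (x - p) = infdist x W" "w \<in> W"
  shows "ip (x - p) w = 0"
proof (cases "w = 0")
  case True
  then show ?thesis
    using ip_diff_right[of "x - p" 0 0] by simp
next
  case False
  define c where "c = ip (x - p) w / ip w w"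
  define u where "u = x - p - scale c w"
  have nz: "ip w w \<noteq> 0"
    using False by (simp add: ip_self)
  have "ip u w = 0"
    using nz by (simp add: u_def c_def ip_diff_left ip_scale_left)
  \<comment> \<open>Swapping the arguments lets linearity on the left apply.\<close>
  then have "ip u (scale c w) = 0"
    by (metis ip_eq_0_commute ip_scale_left mult_zero_right)
  from pythagoras[OF this]
  have eq: "(norm (x - p))\<^sup>2 = (norm u)\<^sup>2 + (norm (scale c w))\<^sup>2"
    by (simp add: u_def)
  have "p + scale c w \<in> W"
    using assms by (intro subspace_add subspace_scale)
  then have "norm (x - p) \<le> norm u"
    using assms(3) infdist_le[of "p + scale c w" W x]
    by (simp add: u_def dist_norm algebra_simps)
  then have "(norm (x - p))\<^sup>2 \<le> (norm u)\<^sup>2"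
    by (simp add: power_mono)
  then have "scale c w = 0"
    using eq by simp
  then have "c = 0"
    using False by (simp add: scale_eq_0_iff)
  then show ?thesis
    using nz by (simp add: c_def)
qed

text \<open>The \<open>THE\<close> in the definition is meaningful only once the foot of the
  perpendicular is known to exist and to be unique.\<close>

lemma orthogonal_projection:
  assumes W: "subspace W" "closed W"
  shows orthogonal_projection_in: "orthogonal_projection ip W x \<in> W"
    and orthogonal_projection_orthogonal:
      "w \<in> W \<Longrightarrow> ip (x - orthogonal_projection ip W x) w = 0"
proof -
  have "\<exists>!p. p \<in> W \<and> (\<forall>w\<in>W. ip (x - p) w = 0)"
  proof (rule ex_ex1I)
    show "\<exists>p. p \<in> W \<and> (\<forall>w\<in>W. ip (x - p) w = 0)"
      using nearest_point_exists[OF W] nearest_point_orthogonal[OF W(1)] by metis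
    fix p q
    assume p: "p \<in> W \<and> (\<forall>w\<in>W. ip (x - p) w = 0)" and q: "q \<in> W \<and> (\<forall>w\<in>W. ip (x - q) w = 0)"
    \<comment> \<open>The first argument equals \<open>p - q\<close>, so this vector of
      \<open>W\<close> is orthogonal to itself.\<close>
    then have "ip ((x - q) - (x - p)) (p - q) = 0"
      using subspace_diff[OF W(1)] by (subst ip_diff_left) simp
    then show "p = q"
      by (simp add: ip_self)
  qed
  from theI'[OF this]
  show "orthogonal_projection ip W x \<in> W"
    and "w \<in> W \<Longrightarrow> ip (x - orthogonal_projection ip W x) w = 0"
    by (auto simp: orthogonal_projection_def)
qed

lemma ip_orthogonal_projection_right:
  assumes "subspace W" "closed W" "w \<in> W"
  shows "ip w (orthogonal_projection ip W x) = ip w x"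
  using orthogonal_projection_orthogonal[OF assms, of x]
  by (subst (asm) ip_eq_0_commute) (simp add: ip_diff_right)

text \<open>The sums agree term by term, so summability and both bounds carry over. The index set is
  arbitrary, which serves both the single frames and the pairs \<open>(j, i)\<close> of a
  weaving.\<close>

lemma frame_with_bounds_orthogonal_projection:
  assumes "subspace W" "closed W" "frame_with_bounds ip UNIV I g A B"
  shows "frame_with_bounds ip W I (\<lambda>i. orthogonal_projection ip W (g i)) A B"
  using assms(3)
  by (auto simp: frame_with_bounds_def ip_orthogonal_projection_right[OF assms(1,2)]
      orthogonal_projection_in[OF assms(1,2)])

lemma woven_frame_orthogonal_projection:
  assumes "subspace W" "closed W" "woven_frame ip UNIV I m f C D"
  shows "woven_frame ip W I m (\<lambda>i j. orthogonal_projection ip W (f i j)) C D"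
proof -
  have "frame ip W I (\<lambda>i. orthogonal_projection ip W (f i j))" if "j \<in> {1..m}" for j
    using assms(3) that frame_with_bounds_orthogonal_projection[OF assms(1,2)]
    unfolding woven_frame_def frame_def by blast
  moreover have "frame_with_bounds ip W (SIGMA j:{1..m}. \<sigma> j)
      (\<lambda>(j, i). orthogonal_projection ip W (f i j)) C D" if "indexed_partition I m \<sigma>" for \<sigma>
    using assms(3) that
      frame_with_bounds_orthogonal_projection[OF assms(1,2), of _ "\<lambda>(j, i). f i j"]
    unfolding woven_frame_def by (simp add: case_prod_unfold)
  ultimately show ?thesis
    using assms(3) unfolding woven_frame_def by blast
qed

end

theorem theorem3p12:
  fixes scale :: "'k::conj_normed_field \<Rightarrow> 'h::banach \<Rightarrow> 'h"
    and ip :: "'h \<Rightarrow> 'h \<Rightarrow> 'k"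
    and I :: "'i set" and m :: nat
    and f :: "'i \<Rightarrow> nat \<Rightarrow> 'h"
    and C D :: real
    and W :: "'h set"
  assumes "hilbert_space scale ip"
    and "separable_space (euclidean :: 'h topology)"
    and "countable I"
    and "woven_frame ip UNIV I m f C D"
    and "module.subspace scale W" and "closed W"
  shows "woven_frame ip W I m (\<lambda>i j. orthogonal_projection ip W (f i j)) C D"
  using hilbert_space.woven_frame_orthogonal_projection[OF assms(1,5,6,4)] .

end
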